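(* Let $k^2$ and $k_0^2$ be real continuous functions on $\mathbb{R}$ tending to the same positive limits $k^2(\pm\infty)=k_0^2(\pm\infty)$ as $x\to\pm\infty$, and let $\psi_0$ be the scattering solution of $\psi_0''+k_0^2\psi_0=0$, normalized to unit flux, as defined in the context. Let $\alpha_0,\beta_0,T_0$ (respectively $\alpha,\beta,T$) denote the Bogoliubov coefficients and transmission probability of the problem with $k_0^2$ (respectively $k^2$). Put $$\Theta_{\mathrm{b}}=\frac12\int_{-\infty}^{+\infty}|k^2-k_0^2|\,|\psi_0|^2\,dx$$ and assume $\Theta_{\mathrm{b}}<\infty$. Then $$|\alpha|\le\cosh\left\{\cosh^{-1}|\alpha_0|+\Theta_{\mathrm{b}}\right\},\qquad |\beta|\le\sinh\left\{\sinh^{-1}|\beta_0|+\Theta_{\mathrm{b}}\right\},$$ $$T\ge\mathrm{sech}^2\left\{\mathrm{sech}^{-1}(T_0^{1/2})+\Theta_{\mathrm{b}}\right\}=\frac{T_0}{\left[\cosh\Theta_{\mathrm{b}}+\sqrt{1-T_0}\,\sinh\Theta_{\mathrm{b}}\right]^2}.$$ Moreover, if $\Theta_{\mathrm{b}}<\cosh^{-1}|\alpha_0|$ (equivalently $\Theta_{\mathrm b}<\sinh^{-1}|\beta_0|$, equivalently $\Theta_{\mathrm b}<\mathrm{sech}^{-1}(T_0^{1/2})$), then $$|\alpha|\ge\cosh\left\{\cosh^{-1}|\alpha_0|-\Theta_{\mathrm{b}}\right\},\qquad |\beta|\ge\sinh\left\{\sinh^{-1}|\beta_0|-\Theta_{\mathrm{b}}\right\},$$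 $$T\le\mathrm{sech}^2\left\{\mathrm{sech}^{-1}(T_0^{1/2})-\Theta_{\mathrm{b}}\right\}=\frac{T_0}{\left[\cosh\Theta_{\mathrm{b}}-\sqrt{1-T_0}\,\sinh\Theta_{\mathrm{b}}\right]^2}.$$
   Context: Both scattering problems are assumed well defined: writing $k_{\pm\infty}=k(\pm\infty)=k_0(\pm\infty)>0$, the equation $\psi_0''+k_0^2\psi_0=0$ has a solution $\psi_0$ with $\psi_0\sim e^{ik_{-\infty}x}/\sqrt{k_{-\infty}}$ as $x\to-\infty$ and $\psi_0\sim\alpha_0e^{ik_{+\infty}x}/\sqrt{k_{+\infty}}+\beta_0e^{-ik_{+\infty}x}/\sqrt{k_{+\infty}}$ as $x\to+\infty$ (with corresponding asymptotics for derivatives), so that the flux is $\mathrm{Im}(\psi_0^*\psi_0')=1$ and $|\alpha_0|^2-|\beta_0|^2=1$; likewise $\psi''+k^2\psi=0$ with coefficients $\alpha,\beta$. The transmission probabilities are $T_0=1/|\alpha_0|^2$ and $T=1/|\alpha|^2$. Inverse hyperbolic functions take their nonnegative values. In applications $k^2=2m[E-V]/\hbar^2$ and $k_0^2=2m[E-V_0]/\hbar^2$. *)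

theory Defs
  imports "HOL-Analysis.Analysis"
begin

text \<open>
  Unit-flux plane wave \<open>e\<^sup>i\<^sup>k\<^sup>x / sqrt k\<close>; its complex conjugate is the wave travelling
  in the opposite direction, and its derivative is \<open>\<i> k\<close> times itself.
\<close>

definition plane_wave :: "real \<Rightarrow> real \<Rightarrow> complex" where
  "plane_wave k x = exp (\<i> * of_real (k * x)) / of_real (sqrt k)"

text \<open>
  The first argument \<open>q\<close> is the function written \<open>k\<^sup>2\<close> in the equation \<open>\<psi>'' + k\<^sup>2 \<psi> = 0\<close>;
  it may be negative at finite \<open>x\<close>. The numbers \<open>km\<close> and \<open>kp\<close> are the asymptotic wave numbers
  at minus and plus infinity. An asymptotic relation \<open>f \<sim> g\<close> between these bounded oscillating
  functions means that \<open>f - g\<close> tends to 0.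
\<close>

definition scattering_solution ::
  "(real \<Rightarrow> real) \<Rightarrow> real \<Rightarrow> real \<Rightarrow> (real \<Rightarrow> complex) \<Rightarrow> complex \<Rightarrow> complex \<Rightarrow> bool" where
  "scattering_solution q km kp \<psi> \<alpha> \<beta> \<longleftrightarrow>
    (\<exists>\<psi>'.
      (\<forall>x. (\<psi> has_vector_derivative \<psi>' x) (at x)) \<and>
      (\<forall>x. (\<psi>' has_vector_derivative - (of_real (q x) * \<psi> x)) (at x)) \<and>
      ((\<lambda>x. \<psi> x - plane_wave km x) \<longlongrightarrow> 0) at_bot \<and>
      ((\<lambda>x. \<psi>' x - \<i> * of_real km * plane_wave km x) \<longlongrightarrow> 0) at_bot \<and>
      ((\<lambda>x. \<psi> x - (\<alpha> * plane_wave kp x + \<beta> * cnj (plane_wave kp x))) \<longlongrightarrow> 0) at_top \<and>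
      ((\<lambda>x. \<psi>' x - \<i> * of_real kp *
          (\<alpha> * plane_wave kp x - \<beta> * cnj (plane_wave kp x))) \<longlongrightarrow> 0) at_top)"

definition sech :: "real \<Rightarrow> real" where
  "sech x = 1 / cosh x"

definition arsech :: "real \<Rightarrow> real" where
  "arsech t = (THE y. 0 \<le> y \<and> sech y = t)"

lemma arsech_eq_arcosh:
  assumes "0 < t" "t \<le> 1"
  shows "arsech t = arcosh (1 / t)"
  unfolding arsech_def
proof (rule the_equality)
  have "1 \<le> 1 / t" using assms by simp
  then show "0 \<le> arcosh (1 / t) \<and> sech (arcosh (1 / t)) = t"
    by (simp add: sech_def arcosh_nonneg_real)
next
  fix y assume "0 \<le> y \<and> sech y = t"
  then have "0 \<le> y" "1 / t = cosh y" by (auto simp: sech_def)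
  then show "y = arcosh (1 / t)" by (simp add: arcosh_cosh_real)
qed

end

theory Submission
  imports Defs
begin

text \<open>
  Write \<open>\<psi> = a \<psi>0 + b cnj \<psi>0\<close> with \<open>a, b\<close> fixed by variation of constants, so that
  \<open>a = W(\<psi>, cnj \<psi>0) / (-2\<i>)\<close> and \<open>b = W(\<psi>0, \<psi>) / (-2\<i>)\<close> for the Wronskian \<open>W\<close>. Conservation of
  flux gives \<open>|a|\<^sup>2 - |b|\<^sup>2 = 1\<close>, i.e. \<open>|a| = cosh \<theta>\<close> and \<open>|b| = sinh \<theta>\<close>, and the equations give
  \<open>|\<theta>'| \<le> |k\<^sup>2 - k0\<^sup>2| |\<psi>0|\<^sup>2 / 2\<close>. Since \<open>\<theta>\<close> vanishes at minus infinity, \<open>\<theta> \<le> \<Theta>\<close> at plus infinity.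
  There \<open>\<alpha> = a \<alpha>0 + b cnj \<beta>0\<close> and \<open>\<beta> = a \<beta>0 + b cnj \<alpha>0\<close>, and the bounds are the triangle
  inequality together with the addition theorems of cosh and sinh.
\<close>

section \<open>Wronskians of solutions with plane-wave asymptotics\<close>

definition wronskian :: "('a \<Rightarrow> complex) \<Rightarrow> ('a \<Rightarrow> complex) \<Rightarrow> ('a \<Rightarrow> complex) \<Rightarrow> ('a \<Rightarrow> complex) \<Rightarrow> 'a \<Rightarrow> complex"
  where "wronskian f f' g g' x = f x * g' x - f' x * g x"

text \<open>Waves in both directions and an arbitrary filter are allowed so that the two ends share
  one notion: the incoming side is \<open>at_bot\<close> with coefficients 1 and 0.\<close>

definition plane_asymp ::
  "real \<Rightarrow> real filter \<Rightarrow> (real \<Rightarrow> complex) \<Rightarrow> (real \<Rightarrow> complex) \<Rightarrow> complex \<Rightarrow> complex \<Rightarrow> bool" where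
  "plane_asymp k F f f' \<alpha> \<beta> \<longleftrightarrow>
    ((\<lambda>x. f x - (\<alpha> * plane_wave k x + \<beta> * cnj (plane_wave k x))) \<longlongrightarrow> 0) F \<and>
    ((\<lambda>x. f' x - \<i> * of_real k * (\<alpha> * plane_wave k x - \<beta> * cnj (plane_wave k x))) \<longlongrightarrow> 0) F"

definition wave_solution :: "(real \<Rightarrow> real) \<Rightarrow> (real \<Rightarrow> complex) \<Rightarrow> (real \<Rightarrow> complex) \<Rightarrow> bool" where
  "wave_solution q f f' \<longleftrightarrow>
    (\<forall>x. (f has_vector_derivative f' x) (at x)) \<and>
    (\<forall>x. (f' has_vector_derivative - (of_real (q x) * f x)) (at x))"

lemma scattering_solution_iff:
  "scattering_solution q km kp \<psi> \<alpha> \<beta> \<longleftrightarrow>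
    (\<exists>\<psi>'. wave_solution q \<psi> \<psi>' \<and> plane_asymp km at_bot \<psi> \<psi>' 1 0 \<and> plane_asymp kp at_top \<psi> \<psi>' \<alpha> \<beta>)"
  unfolding scattering_solution_def wave_solution_def plane_asymp_def by (simp add: conj_assoc)

lemma wave_solution_cnj:
  assumes "wave_solution q f f'"
  shows "wave_solution q (\<lambda>x. cnj (f x)) (\<lambda>x. cnj (f' x))"
proof -
  have "((\<lambda>x. cnj (f x)) has_vector_derivative cnj (f' x)) (at x)"
    "((\<lambda>x. cnj (f' x)) has_vector_derivative cnj (- (of_real (q x) * f x))) (at x)" for x
    using assms unfolding wave_solution_def by (blast intro: has_vector_derivative_cnj)+
  then show ?thesis
    by (simp add: wave_solution_def)
qed

text \<open>Conjugation reverses the direction of travel, which exchanges the roles of the two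
  coefficients.\<close>

lemma plane_asymp_cnj:
  assumes "plane_asymp k F f f' \<alpha> \<beta>"
  shows "plane_asymp k F (\<lambda>x. cnj (f x)) (\<lambda>x. cnj (f' x)) (cnj \<beta>) (cnj \<alpha>)"
proof -
  note lim = assms[unfolded plane_asymp_def]
  show ?thesis
    using tendsto_cnj[OF conjunct1[OF lim]] tendsto_cnj[OF conjunct2[OF lim]]
    unfolding plane_asymp_def by (simp add: algebra_simps)
qed

lemma plane_wave_mult_cnj:
  assumes "k > 0"
  shows "plane_wave k x * cnj (plane_wave k x) = 1 / of_real k"
proof -
  have "cmod (plane_wave k x) = 1 / sqrt k"
    using assms by (simp add: plane_wave_def norm_divide)
  then show ?thesis
    using assms by (simp add: complex_norm_square[symmetric] power_divide flip: of_real_power)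
qed

text \<open>The error is (f - F)(g - G) + (f - F)G + F(g - G), and each term has a factor tending to
  0. Limits of products do not apply directly, since plane waves oscillate and are only
  bounded.\<close>

lemma tendsto_mult_diff_bounded:
  fixes f g F G :: "'a \<Rightarrow> 'b::real_normed_algebra"
  assumes "((\<lambda>x. f x - F x) \<longlongrightarrow> 0) X" and "((\<lambda>x. g x - G x) \<longlongrightarrow> 0) X"
    and "\<And>x. norm (F x) \<le> A" and "\<And>x. norm (G x) \<le> B"
  shows "((\<lambda>x. f x * g x - F x * G x) \<longlongrightarrow> 0) X"
proof -
  have bF: "Bfun F X" and bG: "Bfun G X"
    using assms(3,4) by (auto intro!: BfunI always_eventually)
  have zf: "Zfun (\<lambda>x. f x - F x) X" and zg: "Zfun (\<lambda>x. g x - G x) X"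
    using assms(1,2) by (simp_all add: tendsto_Zfun_iff)
  have "Zfun (\<lambda>x. (f x - F x) * (g x - G x) + (f x - F x) * G x + F x * (g x - G x)) X"
    by (intro Zfun_add bounded_bilinear.Zfun[OF bounded_bilinear_mult zf zg]
        bounded_bilinear.Zfun_prod_Bfun[OF bounded_bilinear_mult zf bG]
        bounded_bilinear.Bfun_prod_Zfun[OF bounded_bilinear_mult bF zg])
  then show ?thesis by (simp add: tendsto_Zfun_iff algebra_simps)
qed

text \<open>Replacing solutions by their plane waves costs an error tending to 0. In the Wronskian
  of the plane waves the oscillating products cancel, and the cross terms are constant because
  \<open>plane_wave k x\<close> has modulus 1 / sqrt k.\<close>

lemma wronskian_tendsto:
  assumes "k > 0" "plane_asymp k F f f' \<alpha> \<beta>" "plane_asymp k F g g' \<gamma> \<delta>"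
  shows "(wronskian f f' g g' \<longlongrightarrow> - 2 * \<i> * (\<alpha> * \<delta> - \<beta> * \<gamma>)) F"
proof -
  let ?p = "plane_wave k"
  let ?P = "\<lambda>\<alpha> \<beta> x. \<alpha> * ?p x + \<beta> * cnj (?p x)"
  let ?P' = "\<lambda>\<alpha> \<beta> x. \<i> * of_real k * (\<alpha> * ?p x - \<beta> * cnj (?p x))"
  have p: "cmod (?p x) = 1 / sqrt k" for x
    using assms by (simp add: plane_wave_def norm_divide)
  have bP: "cmod (?P a b x) \<le> (cmod a + cmod b) / sqrt k" for a b x
    by (rule order_trans[OF norm_triangle_ineq]) (simp add: norm_mult p add_divide_distrib)
  have bP': "cmod (?P' a b x) \<le> k * ((cmod a + cmod b) / sqrt k)" for a b x
    using norm_triangle_ineq4[of "a * ?p x" "b * cnj (?p x)"] \<open>k > 0\<close>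
    by (simp add: norm_mult p add_divide_distrib)
  have "((\<lambda>x. f x * g' x - ?P \<alpha> \<beta> x * ?P' \<gamma> \<delta> x) \<longlongrightarrow> 0) F"
    using assms(2,3) by (intro tendsto_mult_diff_bounded[OF _ _ bP bP'])
      (auto simp: plane_asymp_def)
  moreover have "((\<lambda>x. f' x * g x - ?P' \<alpha> \<beta> x * ?P \<gamma> \<delta> x) \<longlongrightarrow> 0) F"
    using assms(2,3) by (intro tendsto_mult_diff_bounded[OF _ _ bP' bP])
      (auto simp: plane_asymp_def)
  ultimately have "((\<lambda>x. (f x * g' x - ?P \<alpha> \<beta> x * ?P' \<gamma> \<delta> x) -
      (f' x * g x - ?P' \<alpha> \<beta> x * ?P \<gamma> \<delta> x)) \<longlongrightarrow> 0 - 0) F"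
    by (rule tendsto_diff)
  moreover have "(f x * g' x - ?P \<alpha> \<beta> x * ?P' \<gamma> \<delta> x) - (f' x * g x - ?P' \<alpha> \<beta> x * ?P \<gamma> \<delta> x)
      = wronskian f f' g g' x - (- 2 * \<i> * (\<alpha> * \<delta> - \<beta> * \<gamma>))" for x
  proof -
    have "?P \<alpha> \<beta> x * ?P' \<gamma> \<delta> x - ?P' \<alpha> \<beta> x * ?P \<gamma> \<delta> x
        = - 2 * \<i> * (\<alpha> * \<delta> - \<beta> * \<gamma>) * (of_real k * (?p x * cnj (?p x)))"
      by (simp add: algebra_simps)
    also have "\<dots> = - 2 * \<i> * (\<alpha> * \<delta> - \<beta> * \<gamma>)"
      using \<open>k > 0\<close> by (simp add: plane_wave_mult_cnj)
    finally show ?thesis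
      by (simp add: wronskian_def algebra_simps)
  qed
  ultimately have "((\<lambda>x. wronskian f f' g g' x - (- 2 * \<i> * (\<alpha> * \<delta> - \<beta> * \<gamma>))) \<longlongrightarrow> 0) F"
    by simp
  then show ?thesis
    by (subst (asm) LIM_zero_iff)
qed

text \<open>The products of first derivatives cancel. Equal \<open>q\<close> and \<open>r\<close>
  give conservation laws; different ones give the evolution of the coefficient b.\<close>

lemma has_vector_derivative_wronskian:
  assumes "wave_solution q f f'" "wave_solution r g g'"
  shows "(wronskian f f' g g' has_vector_derivative of_real (q x - r x) * (f x * g x)) (at x)"
proof -
  have "((\<lambda>x. f x * g' x - f' x * g x) has_vector_derivative
      (f x * (- (of_real (r x) * g x)) + f' x * g' x) -
      (f' x * g' x + (- (of_real (q x) * f x)) * g x)) (at x)"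
    using assms unfolding wave_solution_def
    by (intro has_vector_derivative_diff has_vector_derivative_mult) auto
  then show ?thesis
    unfolding wronskian_def[abs_def] by (simp add: algebra_simps)
qed

lemma wronskian_constant:
  assumes "wave_solution q f f'" "wave_solution q g g'" "(wronskian f f' g g' \<longlongrightarrow> c) F" "F \<noteq> bot"
  shows "wronskian f f' g g' x = c"
proof -
  have "(wronskian f f' g g' has_vector_derivative 0) (at y)" for y
    using has_vector_derivative_wronskian[OF assms(1,2), of y] by simp
  then obtain d where "wronskian f f' g g' y = d" for y
    using has_vector_derivative_zero_constant[of UNIV "wronskian f f' g g'"] by auto
  then have "wronskian f f' g g' = (\<lambda>_. wronskian f f' g g' x)"
    by auto
  then show ?thesis
    using assms(3,4) by (metis tendsto_const tendsto_unique)
qed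

text \<open>This Wronskian is -2\<i> times the flux Im(cnj f * f'), so the flux can be read off from
  the asymptotics at either end.\<close>

lemma flux_wronskian:
  assumes "wave_solution q f f'" "plane_asymp k F f f' \<alpha> \<beta>" "k > 0" "F \<noteq> bot"
  shows "wronskian f f' (\<lambda>x. cnj (f x)) (\<lambda>x. cnj (f' x)) x
    = - 2 * \<i> * of_real ((cmod \<alpha>)\<^sup>2 - (cmod \<beta>)\<^sup>2)"
  using wronskian_constant[OF assms(1) wave_solution_cnj[OF assms(1)]
      wronskian_tendsto[OF assms(3) assms(2) plane_asymp_cnj[OF assms(2)]] assms(4), of x]
  by (simp add: complex_norm_square flip: of_real_power)

lemma flux_conservation:
  assumes "wave_solution q f f'" "plane_asymp k F f f' \<alpha> \<beta>" "k > 0" "F \<noteq> bot"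
    "plane_asymp l G f f' \<gamma> \<delta>" "l > 0" "G \<noteq> bot"
  shows "(cmod \<alpha>)\<^sup>2 - (cmod \<beta>)\<^sup>2 = (cmod \<gamma>)\<^sup>2 - (cmod \<delta>)\<^sup>2"
  using flux_wronskian[OF assms(1-4), of 0] flux_wronskian[OF assms(1) assms(5-7), of 0]
  by (simp del: of_real_diff of_real_power)

section \<open>Integrating a differential inequality over the line\<close>

lemma has_real_derivative_cmod_power2:
  assumes "(b has_vector_derivative b') (at x)"
  shows "((\<lambda>x. (cmod (b x))\<^sup>2) has_real_derivative 2 * Re (cnj (b x) * b')) (at x)"
proof -
  have "((\<lambda>x. Re (b x)) has_real_derivative Re b') (at x)"
    "((\<lambda>x. Im (b x)) has_real_derivative Im b') (at x)"
    using bounded_linear.has_vector_derivative[OF bounded_linear_Re assms]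
      bounded_linear.has_vector_derivative[OF bounded_linear_Im assms]
    by (simp_all add: has_real_derivative_iff_has_vector_derivative)
  from DERIV_add[OF DERIV_power[OF this(1), of 2] DERIV_power[OF this(2), of 2]] show ?thesis
    unfolding cmod_power2 by (simp add: algebra_simps)
qed

text \<open>Links the gauge integral of the fundamental theorem of calculus to the Lebesgue integral
  that defines \<Theta>; nonnegativity lets the interval grow to the whole line.\<close>

lemma integral_Icc_le_lborel:
  fixes g :: "real \<Rightarrow> real"
  assumes "continuous_on UNIV g" "\<And>x. 0 \<le> g x" "integrable lborel g"
  shows "integral {x..y} g \<le> (\<integral>x. g x \<partial>lborel)"
proof -
  have "set_integrable lborel {x..y} g"
    using assms(3) unfolding set_integrable_def by (rule integrable_mult_indicator[rotated]) simp
  then have "integral {x..y} g = (LINT t:{x..y}|lborel. g t)"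
    by (simp add: set_borel_integral_eq_integral)
  also have "\<dots> \<le> (\<integral>x. g x \<partial>lborel)"
    unfolding set_lebesgue_integral_def
    using assms(2,3) by (intro integral_mono' assms) (auto simp: indicator_def)
  finally show ?thesis .
qed

text \<open>
  The function \<open>arsinh (sqrt w)\<close> need not be differentiable where \<open>w\<close> vanishes; regularizing the
  second root in \<open>arsinh (sqrt w) = ln (sqrt (1 + w) + sqrt w)\<close> preserves the differential inequality.
\<close>

lemma arsinh_sqrt_growth_bound:
  fixes w w' g :: "real \<Rightarrow> real"
  assumes w: "\<And>x. (w has_real_derivative w' x) (at x)" "\<And>x. 0 \<le> w x"
    and w': "\<And>x. \<bar>w' x\<bar> \<le> 2 * g x * (sqrt (1 + w x) * sqrt (w x))"
    and g: "continuous_on UNIV g" "\<And>x. 0 \<le> g x" "integrable lborel g"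
    and lim: "(w \<longlongrightarrow> 0) at_bot" "(w \<longlongrightarrow> L) at_top"
  shows "arsinh (sqrt L) \<le> (\<integral>x. g x \<partial>lborel)"
proof -
  let ?I = "\<integral>x. g x \<partial>lborel"
  let ?f = "\<lambda>\<epsilon> u. ln (sqrt (1 + u) + sqrt (u + \<epsilon>)) :: real"
  have L: "0 \<le> L"
    using lim(2) w(2) by (intro tendsto_lowerbound[of w L at_top 0]) auto
  \<comment> \<open>The bound is independent of x, y and \<epsilon>, so the limits x to minus
    infinity, y to plus infinity and \<epsilon> to 0 can be taken in this order.\<close>
  have step: "?f \<epsilon> (w y) - ?f \<epsilon> (w x) \<le> ?I" if "x \<le> y" "\<epsilon> > 0" for x y \<epsilon>
  proof -
    let ?d = "\<lambda>t. w' t / (2 * (sqrt (1 + w t) * sqrt (w t + \<epsilon>)))"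
    have pos: "1 + w t > 0" "w t + \<epsilon> > 0" for t
      using w(2)[of t] \<open>\<epsilon> > 0\<close> by auto
    have spos: "sqrt (1 + w t) > 0" "sqrt (w t + \<epsilon>) > 0" for t
      using pos[of t] by auto
    have der: "((\<lambda>t. ?f \<epsilon> (w t)) has_real_derivative ?d t) (at t)" for t
    proof -
      have s: "((\<lambda>t. sqrt (1 + w t)) has_real_derivative w' t / (2 * sqrt (1 + w t))) (at t)"
        "((\<lambda>t. sqrt (w t + \<epsilon>)) has_real_derivative w' t / (2 * sqrt (w t + \<epsilon>))) (at t)"
        using pos[of t] by (auto intro!: derivative_eq_intros w(1) simp: field_simps)
      have "((\<lambda>t. ?f \<epsilon> (w t)) has_real_derivative
          (w' t / (2 * sqrt (1 + w t)) + w' t / (2 * sqrt (w t + \<epsilon>))) * 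
          (1 / (sqrt (1 + w t) + sqrt (w t + \<epsilon>)))) (at t)"
        using DERIV_chain2[OF DERIV_ln_divide DERIV_add[OF s]] spos[of t]
        by (simp add: mult.commute add_pos_pos)
      \<comment> \<open>With p and q the two roots, the derivative of p + q contains the factor p +
        q, which cancels the argument of the logarithm.\<close>
      moreover have "(v / (2 * p) + v / (2 * q)) * (1 / (p + q)) = v / (2 * (p * q))"
        if "p > 0" "q > 0" for v p q :: real
      proof -
        have "p + q \<noteq> 0" using that by simp
        have "(v / (2 * p) + v / (2 * q)) = v * (p + q) / (2 * (p * q))"
          using that by (simp add: field_simps)
        then show ?thesis using \<open>p + q \<noteq> 0\<close> by simp
      qed
      ultimately show ?thesis
        using spos[of t] by simp
    qed
    \<comment> \<open>The hypothesis on \<open>w'\<close> survives regularization because sqrt w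
      \<le> sqrt (w + \<epsilon>).\<close>
    have le: "?d t \<le> g t" for t
    proof -
      have "w' t \<le> 2 * g t * (sqrt (1 + w t) * sqrt (w t))"
        using w'[of t] by linarith
      also have "\<dots> \<le> 2 * g t * (sqrt (1 + w t) * sqrt (w t + \<epsilon>))"
        using g(2)[of t] w(2)[of t] \<open>\<epsilon> > 0\<close> by (intro mult_left_mono) auto
      finally show ?thesis
        using spos[of t] by (simp add: divide_le_eq algebra_simps)
    qed
    have "(?d has_integral ?f \<epsilon> (w y) - ?f \<epsilon> (w x)) {x..y}"
      using der by (intro fundamental_theorem_of_calculus \<open>x \<le> y\<close>)
        (simp add: has_real_derivative_iff_has_vector_derivative has_vector_derivative_at_within)
    moreover have "(g has_integral integral {x..y} g) {x..y}"
      using g(1) by (intro integrable_integral integrable_continuous_real) (rule continuous_on_subset, auto)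
    ultimately have "?f \<epsilon> (w y) - ?f \<epsilon> (w x) \<le> integral {x..y} g"
      using le by (rule has_integral_le)
    then show ?thesis
      using integral_Icc_le_lborel[OF g, of x y] by linarith
  qed
  have bound: "?f \<epsilon> L - ?f \<epsilon> 0 \<le> ?I" if "\<epsilon> > 0" for \<epsilon>
  proof -
    have left: "?f \<epsilon> (w y) - ?f \<epsilon> 0 \<le> ?I" for y
    proof (rule tendsto_upperbound)
      show "((\<lambda>x. ?f \<epsilon> (w y) - ?f \<epsilon> (w x)) \<longlongrightarrow> ?f \<epsilon> (w y) - ?f \<epsilon> 0) at_bot"
        using \<open>\<epsilon> > 0\<close> by (intro tendsto_intros lim) (auto simp: add_pos_pos less_imp_neq[symmetric])
      show "\<forall>\<^sub>F x in at_bot. ?f \<epsilon> (w y) - ?f \<epsilon> (w x) \<le> ?I"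
        using step \<open>\<epsilon> > 0\<close> by (intro eventually_mono[OF eventually_le_at_bot[of y]])
    qed simp
    have "sqrt (1 + L) + sqrt (L + \<epsilon>) > 0"
      using L \<open>\<epsilon> > 0\<close> by (intro add_pos_pos) auto
    then have "((\<lambda>y. ?f \<epsilon> (w y) - ?f \<epsilon> 0) \<longlongrightarrow> ?f \<epsilon> L - ?f \<epsilon> 0) at_top"
      by (intro tendsto_intros lim) auto
    then show ?thesis
      using left by (intro tendsto_upperbound) auto
  qed
  \<comment> \<open>The argument of the logarithm stays positive at \<epsilon> = 0, so the limit
    exists there; it equals arsinh (sqrt L), as the subtracted term is ln 1 = 0.\<close>
  have "sqrt (1 + L) + sqrt (L + 0) > 0"
    using L by (intro add_pos_nonneg) auto
  then have "((\<lambda>\<epsilon>. ?f \<epsilon> L - ?f \<epsilon> 0) \<longlongrightarrow> ?f 0 L - ?f 0 0) (at_right 0)"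
    by (intro tendsto_intros) auto
  then have "?f 0 L - ?f 0 0 \<le> ?I"
    using bound by (rule tendsto_upperbound[OF _ eventually_mono[OF eventually_at_right_less]]) auto
  then show ?thesis
    using L by (simp add: arsinh_real_def add.commute)
qed

section \<open>Expanding the perturbed solution in the unperturbed ones\<close>

text \<open>Cramer's rule for three vectors in a plane: (f, f') is a combination of (u, u') and (v,
  v') with 2 by 2 determinants as coefficients. Only the first component is recorded.\<close>

lemma wronskian_expansion:
  "wronskian u u' v v' x * f x = wronskian f f' v v' x * u x + wronskian u u' f f' x * v x"
  by (simp add: wronskian_def algebra_simps)

lemma bogoliubov_bound:
  fixes k2 k02 :: "real \<Rightarrow> real"
  assumes cont: "continuous_on UNIV k2" "continuous_on UNIV k02"
    and k: "km > 0" "kp > 0"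
    and sol0: "scattering_solution k02 km kp \<psi>0 \<alpha>0 \<beta>0"
    and sol: "scattering_solution k2 km kp \<psi> \<alpha> \<beta>"
    and int: "integrable lborel (\<lambda>x. \<bar>k2 x - k02 x\<bar> * (cmod (\<psi>0 x))\<^sup>2)"
  obtains A B where "\<alpha> = A * \<alpha>0 + B * cnj \<beta>0" "\<beta> = A * \<beta>0 + B * cnj \<alpha>0"
    "(cmod A)\<^sup>2 = 1 + (cmod B)\<^sup>2" "(cmod \<alpha>0)\<^sup>2 = 1 + (cmod \<beta>0)\<^sup>2" "(cmod \<alpha>)\<^sup>2 = 1 + (cmod \<beta>)\<^sup>2"
    "arsinh (cmod B) \<le> 1 / 2 * (\<integral>x. \<bar>k2 x - k02 x\<bar> * (cmod (\<psi>0 x))\<^sup>2 \<partial>lborel)"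
proof -
  obtain \<psi>0' where s0: "wave_solution k02 \<psi>0 \<psi>0'"
    and l0: "plane_asymp km at_bot \<psi>0 \<psi>0' 1 0" and r0: "plane_asymp kp at_top \<psi>0 \<psi>0' \<alpha>0 \<beta>0"
    using sol0 unfolding scattering_solution_iff by blast
  obtain \<psi>' where s: "wave_solution k2 \<psi> \<psi>'"
    and l: "plane_asymp km at_bot \<psi> \<psi>' 1 0" and r: "plane_asymp kp at_top \<psi> \<psi>' \<alpha> \<beta>"
    using sol unfolding scattering_solution_iff by blast
  have n0: "(cmod \<alpha>0)\<^sup>2 = 1 + (cmod \<beta>0)\<^sup>2"
    using flux_conservation[OF s0 l0 k(1) _ r0 k(2)] by simp
  have n: "(cmod \<alpha>)\<^sup>2 = 1 + (cmod \<beta>)\<^sup>2"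
    using flux_conservation[OF s l k(1) _ r k(2)] by simp
  let ?c0 = "\<lambda>x. cnj (\<psi>0 x)" and ?c0' = "\<lambda>x. cnj (\<psi>0' x)"
  let ?d = "\<lambda>x. cnj (\<psi> x)" and ?d' = "\<lambda>x. cnj (\<psi>' x)"
  have W0: "wronskian \<psi>0 \<psi>0' ?c0 ?c0' x = - 2 * \<i>" for x
    using flux_wronskian[OF s0 l0 k(1)] by simp
  have W: "wronskian \<psi> \<psi>' ?d ?d' x = - 2 * \<i>" for x
    using flux_wronskian[OF s l k(1)] by simp
  \<comment> \<open>The factor \<open>\<i> / 2\<close> is the inverse of -2\<i>, the Wronskian of
    \<psi>0 and its conjugate.\<close>
  define a where "a x = wronskian \<psi> \<psi>' ?c0 ?c0' x * (\<i> / 2)" for x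
  define b where "b x = wronskian \<psi>0 \<psi>0' \<psi> \<psi>' x * (\<i> / 2)" for x
  have expand: "\<psi> x = a x * \<psi>0 x + b x * cnj (\<psi>0 x)" for x
  proof -
    have "\<psi> x = \<i> / 2 * (wronskian \<psi>0 \<psi>0' ?c0 ?c0' x * \<psi> x)"
      by (simp add: W0)
    also have "\<dots> = a x * \<psi>0 x + b x * cnj (\<psi>0 x)"
      unfolding wronskian_expansion[of \<psi>0 \<psi>0' ?c0 ?c0' x \<psi> \<psi>'] by (simp add: a_def b_def algebra_simps)
    finally show ?thesis .
  qed
  \<comment> \<open>A polynomial identity turns |a|^2 - |b|^2 into -1/4 times the product of the two
    flux Wronskians, each equal to -2\<i>.\<close>
  have flux: "(cmod (a x))\<^sup>2 = 1 + (cmod (b x))\<^sup>2" for x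
  proof -
    have "of_real ((cmod (a x))\<^sup>2 - (cmod (b x))\<^sup>2) = a x * cnj (a x) - b x * cnj (b x)"
      by (simp add: complex_norm_square del: of_real_power)
    also have "\<dots> = - 1 / 4 * (wronskian \<psi> \<psi>' ?d ?d' x * wronskian \<psi>0 \<psi>0' ?c0 ?c0' x)"
      by (simp add: a_def b_def wronskian_def field_simps)
    also have "\<dots> = of_real 1"
      by (simp add: W W0)
    finally have "(cmod (a x))\<^sup>2 - (cmod (b x))\<^sup>2 = 1"
      by (simp only: of_real_eq_iff)
    then show ?thesis by simp
  qed
  \<comment> \<open>\<open>A\<close> and \<open>B\<close> solve the linear system expressing
    \<alpha>, \<beta> through \<alpha>0, \<beta>0; its determinant |\<alpha>0|^2 - |\<beta>0|^2 is
    1. \<open>B\<close> is also the limit of \<open>b\<close>, which carries the estimate over to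
    it.\<close>
  define A where "A = \<alpha> * cnj \<alpha>0 - \<beta> * cnj \<beta>0"
  define B where "B = \<alpha>0 * \<beta> - \<beta>0 * \<alpha>"
  have scale: "- 2 * \<i> * z * (\<i> / 2) = z" for z
    by (simp add: complex_eq_iff)
  have lim_b_bot: "(b \<longlongrightarrow> 0) at_bot"
    using tendsto_mult[OF wronskian_tendsto[OF k(1) l0 l] tendsto_const[of "\<i> / 2"]]
    unfolding scale b_def[abs_def] by simp
  have lim_b_top: "(b \<longlongrightarrow> B) at_top"
    using tendsto_mult[OF wronskian_tendsto[OF k(2) r0 r] tendsto_const[of "\<i> / 2"]]
    unfolding scale b_def[abs_def] B_def .
  have n0': "\<alpha>0 * cnj \<alpha>0 = 1 + \<beta>0 * cnj \<beta>0" and n': "\<alpha> * cnj \<alpha> = 1 + \<beta> * cnj \<beta>"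
    using n0 n by (simp_all add: complex_norm_square[symmetric])
  let ?\<delta> = "\<lambda>x. k02 x - k2 x"
  let ?b' = "\<lambda>x. of_real (?\<delta> x) * (\<psi>0 x * \<psi> x) * (\<i> / 2)"
  have db: "(b has_vector_derivative ?b' x) (at x)" for x
    unfolding b_def[abs_def] by (intro has_vector_derivative_mult_left has_vector_derivative_wronskian s0 s)
  let ?g = "\<lambda>x. \<bar>k2 x - k02 x\<bar> * (cmod (\<psi>0 x))\<^sup>2 / 2"
  have db_le: "\<bar>2 * Re (cnj (b x) * ?b' x)\<bar> \<le> 2 * ?g x * (sqrt (1 + (cmod (b x))\<^sup>2) * sqrt ((cmod (b x))\<^sup>2))" for x
  proof -
    \<comment> \<open>Inserting the expansion of \<psi> splits off a purely imaginary term with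
      |b|^2, which does not affect the real part. What remains is proportional to |a| |b|, the form
      needed for the growth estimate.\<close>
    have "cnj (b x) * ?b' x = of_real (?\<delta> x) * (\<i> / 2) * (cnj (b x) * a x * (\<psi>0 x)\<^sup>2)
        + \<i> * of_real (?\<delta> x / 2 * (cmod (b x))\<^sup>2 * (cmod (\<psi>0 x))\<^sup>2)"
      unfolding expand[of x] of_real_mult complex_norm_square
      by (simp add: field_simps power2_eq_square del: of_real_diff)
    then have "Re (cnj (b x) * ?b' x) = Re (of_real (?\<delta> x) * (\<i> / 2) * (cnj (b x) * a x * (\<psi>0 x)\<^sup>2))"
      by (simp only: plus_complex.simps Re_i_times Im_complex_of_real minus_zero add_0_right)
    then have "\<bar>Re (cnj (b x) * ?b' x)\<bar> \<le> cmod (of_real (?\<delta> x) * (\<i> / 2) * (cnj (b x) * a x * (\<psi>0 x)\<^sup>2))"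
      by (simp only: abs_Re_le_cmod)
    also have "\<dots> = \<bar>?\<delta> x\<bar> / 2 * (cmod (b x) * cmod (a x) * (cmod (\<psi>0 x))\<^sup>2)"
      by (simp add: norm_mult norm_power norm_divide del: of_real_diff)
    also have "cmod (a x) = sqrt (1 + (cmod (b x))\<^sup>2)"
      by (simp add: flux[symmetric])
    finally have "\<bar>Re (cnj (b x) * ?b' x)\<bar> \<le> ?g x * (sqrt (1 + (cmod (b x))\<^sup>2) * sqrt ((cmod (b x))\<^sup>2))"
      by (simp only: real_sqrt_abs abs_norm_cancel abs_minus_commute[of "k02 x"] mult_ac times_divide_eq_left times_divide_eq_right)
    then show ?thesis
      unfolding abs_mult[of 2] by linarith
  qed
  have cont_g: "continuous_on UNIV ?g"
  proof -
    have "continuous_on UNIV \<psi>0"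
      using s0 by (auto simp: wave_solution_def continuous_on_eq_continuous_at intro: has_vector_derivative_continuous)
    then show ?thesis
      using cont by (intro continuous_intros) auto
  qed
  \<comment> \<open>The growth estimate is applied to w = |b|^2, for which arsinh (sqrt w) is the
    angle \<theta>.\<close>
  have "arsinh (sqrt ((cmod B)\<^sup>2)) \<le> (\<integral>x. ?g x \<partial>lborel)"
  proof (rule arsinh_sqrt_growth_bound)
    show "((\<lambda>x. (cmod (b x))\<^sup>2) has_real_derivative 2 * Re (cnj (b x) * ?b' x)) (at x)" for x
      by (intro has_real_derivative_cmod_power2 db)
    show "((\<lambda>x. (cmod (b x))\<^sup>2) \<longlongrightarrow> 0) at_bot"
      using tendsto_power[OF tendsto_norm[OF lim_b_bot], of 2] by simp
    show "((\<lambda>x. (cmod (b x))\<^sup>2) \<longlongrightarrow> (cmod B)\<^sup>2) at_top"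
      by (intro tendsto_power tendsto_norm lim_b_top)
    show "integrable lborel ?g"
      using int by simp
  qed (use db_le cont_g in auto)
  then have "arsinh (cmod B) \<le> 1 / 2 * (\<integral>x. \<bar>k2 x - k02 x\<bar> * (cmod (\<psi>0 x))\<^sup>2 \<partial>lborel)"
    by simp
  moreover have "\<alpha> = A * \<alpha>0 + B * cnj \<beta>0"
  proof -
    have "A * \<alpha>0 + B * cnj \<beta>0 = \<alpha> * (\<alpha>0 * cnj \<alpha>0 - \<beta>0 * cnj \<beta>0)"
      by (simp add: A_def B_def algebra_simps)
    then show ?thesis by (simp add: n0')
  qed
  moreover have "\<beta> = A * \<beta>0 + B * cnj \<alpha>0"
  proof -
    have "A * \<beta>0 + B * cnj \<alpha>0 = \<beta> * (\<alpha>0 * cnj \<alpha>0 - \<beta>0 * cnj \<beta>0)"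
      by (simp add: A_def B_def algebra_simps)
    then show ?thesis by (simp add: n0')
  qed
  moreover have "(cmod A)\<^sup>2 = 1 + (cmod B)\<^sup>2"
  proof -
    have "A * cnj A - B * cnj B = (\<alpha> * cnj \<alpha> - \<beta> * cnj \<beta>) * (\<alpha>0 * cnj \<alpha>0 - \<beta>0 * cnj \<beta>0)"
      by (simp add: A_def B_def algebra_simps)
    then have "of_real ((cmod A)\<^sup>2 - (cmod B)\<^sup>2) = complex_of_real 1"
      by (simp add: complex_norm_square n0' n' del: of_real_power)
    then have "(cmod A)\<^sup>2 - (cmod B)\<^sup>2 = 1"
      by (simp only: of_real_eq_iff)
    then show ?thesis by simp
  qed
  ultimately show thesis
    using n0 n that by blast
qed

section \<open>Hyperbolic bounds for the composed coefficients\<close>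

lemma arsinh_real_nonneg:
  fixes x :: real
  shows "0 \<le> x \<Longrightarrow> 0 \<le> arsinh x"
  using arsinh_real_neg_iff[of x] by linarith

lemma cosh_arsinh_eq:
  fixes a b :: real
  assumes "0 \<le> a" "a\<^sup>2 = 1 + b\<^sup>2"
  shows "a = cosh (arsinh b)"
  using assms by (simp add: cosh_arsinh_real add.commute real_sqrt_unique)

lemma bogoliubov_composition_bounds:
  fixes \<alpha> \<beta> \<alpha>0 \<beta>0 A B :: complex
  assumes "\<alpha> = A * \<alpha>0 + B * cnj \<beta>0" "\<beta> = A * \<beta>0 + B * cnj \<alpha>0"
    and "(cmod A)\<^sup>2 = 1 + (cmod B)\<^sup>2" "(cmod \<alpha>0)\<^sup>2 = 1 + (cmod \<beta>0)\<^sup>2"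
    and "arsinh (cmod B) \<le> \<Theta>"
  shows "cmod \<alpha> \<le> cosh (arsinh (cmod \<beta>0) + \<Theta>)"
    and "cmod \<beta> \<le> sinh (arsinh (cmod \<beta>0) + \<Theta>)"
    and "\<Theta> \<le> arsinh (cmod \<beta>0) \<Longrightarrow> cosh (arsinh (cmod \<beta>0) - \<Theta>) \<le> cmod \<alpha>"
    and "\<Theta> \<le> arsinh (cmod \<beta>0) \<Longrightarrow> sinh (arsinh (cmod \<beta>0) - \<Theta>) \<le> cmod \<beta>"
proof -
  define t where "t = arsinh (cmod \<beta>0)"
  define \<theta> where "\<theta> = arsinh (cmod B)"
  have t: "0 \<le> t" "cmod \<alpha>0 = cosh t" "cmod \<beta>0 = sinh t"
    and \<theta>: "0 \<le> \<theta>" "\<theta> \<le> \<Theta>" "cmod A = cosh \<theta>" "cmod B = sinh \<theta>"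
    using assms by (auto simp: t_def \<theta>_def arsinh_real_nonneg intro: cosh_arsinh_eq)
  have "cmod \<alpha> \<le> cmod A * cmod \<alpha>0 + cmod B * cmod \<beta>0"
    "cmod A * cmod \<alpha>0 - cmod B * cmod \<beta>0 \<le> cmod \<alpha>"
    using norm_triangle_ineq[of "A * \<alpha>0" "B * cnj \<beta>0"] norm_diff_ineq[of "A * \<alpha>0" "B * cnj \<beta>0"]
    by (simp_all add: assms(1) norm_mult)
  then have \<alpha>: "cmod \<alpha> \<le> cosh (t + \<theta>)" "cosh (t - \<theta>) \<le> cmod \<alpha>"
    by (simp_all add: t \<theta> cosh_add cosh_diff algebra_simps)
  have "cmod \<beta> \<le> cmod A * cmod \<beta>0 + cmod B * cmod \<alpha>0"
    "cmod A * cmod \<beta>0 - cmod B * cmod \<alpha>0 \<le> cmod \<beta>"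
    using norm_triangle_ineq[of "A * \<beta>0" "B * cnj \<alpha>0"] norm_diff_ineq[of "A * \<beta>0" "B * cnj \<alpha>0"]
    by (simp_all add: assms(2) norm_mult)
  then have \<beta>: "cmod \<beta> \<le> sinh (t + \<theta>)" "sinh (t - \<theta>) \<le> cmod \<beta>"
    by (simp_all add: t \<theta> sinh_add sinh_diff algebra_simps)
  \<comment> \<open>From here on \<theta> is replaced by its upper bound \<Theta>. For cosh this
    uses monotonicity on nonnegative arguments, whereas sinh is monotone everywhere.\<close>
  have "cosh (t + \<theta>) \<le> cosh (t + \<Theta>)"
    using t \<theta> by (subst cosh_real_nonneg_le_iff) auto
  with \<alpha>(1) show "cmod \<alpha> \<le> cosh (arsinh (cmod \<beta>0) + \<Theta>)"
    unfolding t_def by (rule order_trans)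
  have "sinh (t + \<theta>) \<le> sinh (t + \<Theta>)"
    using \<theta> by simp
  with \<beta>(1) show "cmod \<beta> \<le> sinh (arsinh (cmod \<beta>0) + \<Theta>)"
    unfolding t_def by (rule order_trans)
  have "sinh (t - \<Theta>) \<le> sinh (t - \<theta>)"
    using \<theta> by simp
  from this \<beta>(2) show "sinh (arsinh (cmod \<beta>0) - \<Theta>) \<le> cmod \<beta>"
    unfolding t_def by (rule order_trans)
  show "cosh (arsinh (cmod \<beta>0) - \<Theta>) \<le> cmod \<alpha>" if "\<Theta> \<le> arsinh (cmod \<beta>0)"
  proof -
    \<comment> \<open>The assumption \<Theta> \<le> t puts both t - \<Theta> and t - \<theta> in the
      range where cosh increases.\<close>
    have "cosh (t - \<Theta>) \<le> cosh (t - \<theta>)"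
      using that \<theta> by (subst cosh_real_nonneg_le_iff) (auto simp: t_def)
    from this \<alpha>(2) show ?thesis
      unfolding t_def by (rule order_trans)
  qed
qed

section \<open>Transmission probabilities\<close>

text \<open>The addition theorem of cosh divided by cosh t. The quotient sinh t / cosh t later
  becomes sqrt (1 - T0), and \<open>s\<close> takes the values \<Theta> and -\<Theta>.\<close>

lemma sech_add_power2:
  "(sech (t + s))\<^sup>2 = (sech t)\<^sup>2 / (cosh s + sinh t / cosh t * sinh s)\<^sup>2"
proof -
  have "sech (t + s) = sech t / (cosh s + sinh t / cosh t * sinh s)"
    using cosh_real_pos[of t] by (simp add: sech_def cosh_add field_simps)
  then show ?thesis by (simp add: power_divide)
qed

lemma sqrt_one_minus_sech_power2:
  assumes "0 \<le> t"
  shows "sqrt (1 - (sech t)\<^sup>2) = sinh t / cosh t"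
proof (rule real_sqrt_unique)
  show "(sinh t / cosh t)\<^sup>2 = 1 - (sech t)\<^sup>2"
    using cosh_real_pos[of t] by (simp add: sech_def sinh_square_eq field_simps)
qed (use assms in simp)

theorem mainTheorem8:
  fixes k2 k02 :: "real \<Rightarrow> real"
    and km kp :: real
    and \<psi>0 \<psi> :: "real \<Rightarrow> complex"
    and \<alpha>0 \<beta>0 \<alpha> \<beta> :: complex
    and T0 T \<Theta> :: real
  assumes "continuous_on UNIV k2" and "continuous_on UNIV k02"
    and "km > 0" and "kp > 0"
    and "(k2 \<longlongrightarrow> km\<^sup>2) at_bot" and "(k02 \<longlongrightarrow> km\<^sup>2) at_bot"
    and "(k2 \<longlongrightarrow> kp\<^sup>2) at_top" and "(k02 \<longlongrightarrow> kp\<^sup>2) at_top"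
    and "scattering_solution k02 km kp \<psi>0 \<alpha>0 \<beta>0"
    and "scattering_solution k2 km kp \<psi> \<alpha> \<beta>"
    and "T0 = 1 / (cmod \<alpha>0)\<^sup>2" and "T = 1 / (cmod \<alpha>)\<^sup>2"
    and "integrable lborel (\<lambda>x. \<bar>k2 x - k02 x\<bar> * (cmod (\<psi>0 x))\<^sup>2)"
    and "\<Theta> = 1 / 2 * (\<integral>x. \<bar>k2 x - k02 x\<bar> * (cmod (\<psi>0 x))\<^sup>2 \<partial>lborel)"
  shows "cmod \<alpha> \<le> cosh (arcosh (cmod \<alpha>0) + \<Theta>) \<and>
    cmod \<beta> \<le> sinh (arsinh (cmod \<beta>0) + \<Theta>) \<and>
    T \<ge> (sech (arsech (sqrt T0) + \<Theta>))\<^sup>2 \<and>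
    (sech (arsech (sqrt T0) + \<Theta>))\<^sup>2 = T0 / (cosh \<Theta> + sqrt (1 - T0) * sinh \<Theta>)\<^sup>2 \<and>
    (\<Theta> < arcosh (cmod \<alpha>0) \<longleftrightarrow> \<Theta> < arsinh (cmod \<beta>0)) \<and>
    (\<Theta> < arcosh (cmod \<alpha>0) \<longleftrightarrow> \<Theta> < arsech (sqrt T0)) \<and>
    (\<Theta> < arcosh (cmod \<alpha>0) \<longrightarrow>
      cmod \<alpha> \<ge> cosh (arcosh (cmod \<alpha>0) - \<Theta>) \<and>
      cmod \<beta> \<ge> sinh (arsinh (cmod \<beta>0) - \<Theta>) \<and>
      T \<le> (sech (arsech (sqrt T0) - \<Theta>))\<^sup>2 \<and>
      (sech (arsech (sqrt T0) - \<Theta>))\<^sup>2 = T0 / (cosh \<Theta> - sqrt (1 - T0) * sinh \<Theta>)\<^sup>2)"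
proof -
  have \<Theta>: "1 / 2 * (\<integral>x. \<bar>k2 x - k02 x\<bar> * (cmod (\<psi>0 x))\<^sup>2 \<partial>lborel) = \<Theta>"
    using assms(14) by (rule sym)
  obtain A B where AB: "\<alpha> = A * \<alpha>0 + B * cnj \<beta>0" "\<beta> = A * \<beta>0 + B * cnj \<alpha>0"
    "(cmod A)\<^sup>2 = 1 + (cmod B)\<^sup>2" "(cmod \<alpha>0)\<^sup>2 = 1 + (cmod \<beta>0)\<^sup>2"
    and n: "(cmod \<alpha>)\<^sup>2 = 1 + (cmod \<beta>)\<^sup>2"
    and \<theta>: "arsinh (cmod B) \<le> \<Theta>"
    by (rule bogoliubov_bound[OF assms(1-4,9,10,13), unfolded \<Theta>])
  \<comment> \<open>This is the common value of arcosh |\<alpha>0|, arsinh |\<beta>0| and arsech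
    (sqrt T0). Hence the three smallness conditions on \<Theta> coincide and all bounds concern t +
    \<Theta> or t - \<Theta>.\<close>
  define t where "t = arsinh (cmod \<beta>0)"
  have t: "0 \<le> t" "cmod \<alpha>0 = cosh t"
    using AB(4) by (auto simp: t_def arsinh_real_nonneg intro: cosh_arsinh_eq)
  have arc: "arcosh (cmod \<alpha>0) = t"
    using t by (simp add: arcosh_cosh_real)
  have T0: "T0 = (sech t)\<^sup>2" and T: "T = 1 / (cmod \<alpha>)\<^sup>2"
    using assms(11,12) t by (simp_all add: sech_def power_divide)
  have sT0: "sqrt T0 = 1 / cosh t"
    using cosh_real_pos[of t] by (simp add: T0 sech_def power_divide real_sqrt_divide)
  have ars: "arsech (sqrt T0) = t"
    using t cosh_real_pos[of t] cosh_real_ge_1[of t] unfolding sT0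
    by (subst arsech_eq_arcosh) (auto simp: arcosh_cosh_real)
  have pos: "cmod \<alpha> > 0"
    using n by (smt (verit) norm_ge_zero zero_le_power2 zero_power2)
  note bounds = bogoliubov_composition_bounds[OF AB \<theta>, folded t_def]
  have eq: "(sech (t + s))\<^sup>2 = T0 / (cosh s + sqrt (1 - T0) * sinh s)\<^sup>2" for s
    unfolding T0 sqrt_one_minus_sech_power2[OF t(1)] by (rule sech_add_power2)
  \<comment> \<open>As T = 1 / |\<alpha>|^2, an upper bound on |\<alpha>| is a lower bound on T, and
    conversely.\<close>
  have lower: "(sech (t + \<Theta>))\<^sup>2 \<le> T"
    using bounds(1) pos by (simp add: T sech_def power_divide frac_le power_mono)
  have upper: "T \<le> (sech (t - \<Theta>))\<^sup>2" if "\<Theta> \<le> t"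
    using bounds(3)[OF that] cosh_real_pos[of "t - \<Theta>"]
    by (simp add: T sech_def power_divide frac_le power_mono)
  show ?thesis
    using bounds lower upper eq[of \<Theta>] eq[of "- \<Theta>"] unfolding arc ars t_def[symmetric] by auto
qed

end
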